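(* Let $q$ be an odd prime power and let $c_1,c_2,c_3\in\mathbb{F}_q[t]\setminus\{0\}$ be such that $c_1+c_2+c_3=0$. There is a constant $C>0$, depending only on $(c_1,c_2,c_3)$ (and hence possibly on $q$), such that for every integer $n\geq 2$, if $A\subset\mathbb{F}_q[t]_{\deg<n}$ contains no non-trivial solutions to $c_1x_1+c_2x_2+c_3x_3=0$ then \[|A|\leq C\,\frac{(\log n)^2}{n}\,q^n.\]
   Context: $\mathbb{F}_q[t]_{\deg<n}$ is the set of polynomials over the finite field $\mathbb{F}_q$ of degree less than $n$ (including $0$), which has $q^n$ elements. A solution in $A$ is a triple $(x_1,x_2,x_3)\in A^3$ with $c_1x_1+c_2x_2+c_3x_3=0$; it is trivial if $x_1=x_2=x_3$ and non-trivial otherwise. $\log$ is the natural logarithm. *)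

theory Defs
  imports Complex_Main "HOL-Library.Cardinality" "HOL-Computational_Algebra.Polynomial"
begin

(* The disjunct p = 0 only matters for n = 0, as the library sets degree 0 = 0. *)
definition polys_deg_less :: "nat \<Rightarrow> 'a::zero poly set" where
  "polys_deg_less n = {p. p = 0 \<or> degree p < n}"

definition solutions_in ::
  "'a::comm_semiring_0 poly \<Rightarrow> 'a poly \<Rightarrow> 'a poly \<Rightarrow> 'a poly set \<Rightarrow> ('a poly \<times> 'a poly \<times> 'a poly) set"
where
  "solutions_in c1 c2 c3 A =
     {(x1, x2, x3). x1 \<in> A \<and> x2 \<in> A \<and> x3 \<in> A \<and> c1 * x1 + c2 * x2 + c3 * x3 = 0}"

definition trivial_triple :: "'b \<times> 'b \<times> 'b \<Rightarrow> bool" where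
  "trivial_triple = (\<lambda>(x1, x2, x3). x1 = x2 \<and> x2 = x3)"

lemma polys_deg_less_0: "polys_deg_less 0 = {0}"
  by (auto simp: polys_deg_less_def)

lemma card_polys_deg_less:
  "card (polys_deg_less n :: 'a::{field,finite} poly set) = CARD('a) ^ n"
proof -
  have "bij_betw Poly {xs. set xs \<subseteq> (UNIV::'a set) \<and> length xs = n} (polys_deg_less n)"
  proof (rule bij_betwI')
    fix xs ys :: "'a list"
    assume "xs \<in> {xs. set xs \<subseteq> UNIV \<and> length xs = n}" "ys \<in> {xs. set xs \<subseteq> UNIV \<and> length xs = n}"
    then have l: "length xs = n" "length ys = n" by auto
    have "xs = ys" if "Poly xs = Poly ys"
    proof (rule nth_equalityI)
      fix i assume "i < length xs"
      moreover have "coeff (Poly xs) i = coeff (Poly ys) i" using that by simp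
      ultimately show "xs ! i = ys ! i" using l by (simp add: nth_default_def)
    qed (use l in simp)
    then show "(Poly xs = Poly ys) = (xs = ys)" by auto
  next
    fix xs :: "'a list"
    assume "xs \<in> {xs. set xs \<subseteq> UNIV \<and> length xs = n}"
    then have l: "length xs = n" by auto
    have "degree (Poly xs) < n" if "Poly xs \<noteq> 0"
    proof (rule ccontr)
      assume "\<not> degree (Poly xs) < n"
      then have "coeff (Poly xs) (degree (Poly xs)) = 0" using l by (simp add: nth_default_def)
      with that show False using leading_coeff_0_iff by blast
    qed
    then show "Poly xs \<in> polys_deg_less n" by (auto simp: polys_deg_less_def)
  next
    fix p :: "'a poly" assume p: "p \<in> polys_deg_less n"
    have "p = Poly (map (coeff p) [0..<n])"
      using p by (intro poly_eqI) (auto simp: nth_default_def polys_deg_less_def coeff_eq_0)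
    then show "\<exists>xs\<in>{xs. set xs \<subseteq> UNIV \<and> length xs = n}. p = Poly xs"
      by (intro bexI[of _ "map (coeff p) [0..<n]"]) auto
  qed
  from bij_betw_same_card[OF this] show ?thesis
    using card_lists_length_eq[of "UNIV::'a set" n] by simp
qed

end

theory Submission
  imports Defs "HOL-Library.FuncSet"
begin

text \<open>
  The proof is the slice rank method of Croot, Lev, Pach and Tao. Multiplication by each \<open>c\<^sub>i\<close>
  is linear over the ground field, so for polynomials of degree below \<open>n\<close> the
  equation is a system of \<open>n + d\<close> linear equations in the coefficients, where \<open>d\<close> is the
  maximal degree of the \<open>c\<^sub>i\<close>, and its indicator function
  \<open>\<Prod>\<^sub>j (1 - L\<^sub>j\<^bsup>q-1\<^esup>)\<close> has degree at most \<open>(q - 1)(n + d)\<close>. Each of its monomials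
  has degree at most \<open>(q - 1)(n + d)/3\<close> in the coefficients of one of the three unknowns. On a set
  without non-trivial solutions the indicator is a diagonal tensor, hence the size of the set is
  at most three times the number of reduced monomials of such degree in \<open>n\<close> variables. The
  mean degree of a reduced monomial is \<open>(q - 1)n/2\<close>, so Chebyshev's inequality bounds this number
  by \<open>O(q\<^sup>n/n)\<close>, which is stronger than required.
\<close>

section \<open>Slice rank of diagonal tensors\<close>

text \<open>Over a finite field, non-trivial kernels come from the pigeonhole principle.\<close>

lemma exists_kernel_vector:
  fixes f :: "'i \<Rightarrow> 'b \<Rightarrow> 'a::{field,finite}"
  assumes "finite S" "finite I" "card I < card S"
  obtains h where "\<And>x. x \<notin> S \<Longrightarrow> h x = 0" "\<exists>x\<in>S. h x \<noteq> 0"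
    "\<And>i. i \<in> I \<Longrightarrow> (\<Sum>x\<in>S. h x * f i x) = 0"
proof -
  \<comment> \<open>Restricting to \<open>I\<close> places the values of \<open>T\<close> in a set
    of \<open>CARD('a) ^ card I\<close> elements, fewer than the \<open>CARD('a) ^ card S\<close>
    arguments. The difference of two arguments with equal image is the kernel vector.\<close>
  define T where "T h = (\<lambda>i\<in>I. \<Sum>x\<in>S. h x * f i x)" for h :: "'b \<Rightarrow> 'a"
  let ?V = "S \<rightarrow>\<^sub>E (UNIV :: 'a set)" and ?W = "I \<rightarrow>\<^sub>E (UNIV :: 'a set)"
  have q: "1 < CARD('a)"
    using card_mono[of "UNIV :: 'a set" "{0,1}"] by simp
  have "finite ?W" using assms by (intro finite_PiE) auto
  moreover have "T ` ?V \<subseteq> ?W" by (auto simp: T_def)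
  ultimately have "card (T ` ?V) \<le> card ?W" by (intro card_mono)
  also have "\<dots> < card ?V"
    using assms q by (simp add: card_PiE)
  finally have "\<not> inj_on T ?V" by (rule pigeonhole)
  then obtain h1 h2 where h: "h1 \<in> ?V" "h2 \<in> ?V" "T h1 = T h2" "h1 \<noteq> h2"
    by (auto simp: inj_on_def)
  let ?h = "\<lambda>x. if x \<in> S then h1 x - h2 x else 0"
  show ?thesis
  proof
    show "\<exists>x\<in>S. ?h x \<noteq> 0"
      using h PiE_ext[OF h(1,2)] by auto
    fix i assume "i \<in> I"
    then have "(\<Sum>x\<in>S. h1 x * f i x) = (\<Sum>x\<in>S. h2 x * f i x)"
      using fun_cong[OF h(3), of i] by (simp add: T_def)
    then show "(\<Sum>x\<in>S. ?h x * f i x) = 0"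
      by (simp add: left_diff_distrib sum_subtractf)
  qed simp
qed

text \<open>A kernel vector of largest support works. If its zeros in \<open>A\<close> outnumbered
  the constraints, a non-zero kernel vector living on these zeros could be added to it, which
  enlarges the support.\<close>

lemma exists_kernel_vector_large_support:
  fixes f :: "'i \<Rightarrow> 'b \<Rightarrow> 'a::{field,finite}"
  assumes "finite A" "finite I"
  obtains h where "\<And>i. i \<in> I \<Longrightarrow> (\<Sum>x\<in>A. h x * f i x) = 0"
    "card A \<le> card {x\<in>A. h x \<noteq> 0} + card I"
proof -
  let ?K = "\<lambda>h. \<forall>i\<in>I. (\<Sum>x\<in>A. h x * f i x) = 0"
  let ?supp = "\<lambda>h :: 'b \<Rightarrow> 'a. {x\<in>A. h x \<noteq> 0}"
  have "?K (\<lambda>_. 0)" by simp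
  moreover have "\<forall>h. ?K h \<longrightarrow> card (?supp h) < Suc (card A)"
    using assms by (auto simp: less_Suc_eq_le intro!: card_mono)
  ultimately have "\<exists>h. ?K h \<and> (\<forall>h'. ?K h' \<longrightarrow> card (?supp h') \<le> card (?supp h))"
    by (rule ex_has_greatest_nat)
  then obtain h where h: "?K h" and max: "\<forall>h'. ?K h' \<longrightarrow> card (?supp h') \<le> card (?supp h)"
    by (elim exE conjE)
  have "card A \<le> card (?supp h) + card I"
  proof (rule ccontr)
    let ?S = "{x\<in>A. h x = 0}"
    assume less: "\<not> card A \<le> card (?supp h) + card I"
    have "A = ?supp h \<union> ?S" by auto
    then have "card A \<le> card (?supp h) + card ?S" by (metis card_Un_le)
    with less have less': "card I < card ?S" by simp
    have "finite ?S" using assms by simp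
    then obtain v where v0: "\<And>x. x \<notin> ?S \<Longrightarrow> v x = 0" and v1: "\<exists>x\<in>?S. v x \<noteq> 0"
      and v: "\<And>i. i \<in> I \<Longrightarrow> (\<Sum>x\<in>?S. v x * f i x) = 0"
      by (rule exists_kernel_vector[OF _ assms(2) less', of f]) (rule that)
    have "(\<Sum>x\<in>A. v x * f i x) = 0" if "i \<in> I" for i
    proof -
      have "(\<Sum>x\<in>A. v x * f i x) = (\<Sum>x\<in>?S. v x * f i x)"
        using assms v0 by (intro sum.mono_neutral_right) auto
      with v that show ?thesis by simp
    qed
    then have "?K (\<lambda>x. h x + v x)"
      using h by (simp add: distrib_right sum.distrib)
    then have "card (?supp (\<lambda>x. h x + v x)) \<le> card (?supp h)" by (rule max[THEN spec, THEN mp])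
    \<comment> \<open>The supports of \<open>h\<close> and \<open>v\<close> are disjoint, so nothing
      cancels in the sum.\<close>
    moreover have "?supp h \<subset> ?supp (\<lambda>x. h x + v x)"
    proof
      have "v x = 0" if "h x \<noteq> 0" for x using v0[of x] that by blast
      then show "?supp h \<subseteq> ?supp (\<lambda>x. h x + v x)" by auto
      obtain x where "x \<in> ?S" "v x \<noteq> 0" using v1 by blast
      then have "x \<in> ?supp (\<lambda>x. h x + v x)" "x \<notin> ?supp h" by simp_all
      then show "?supp h \<noteq> ?supp (\<lambda>x. h x + v x)" by blast
    qed
    then have "card (?supp h) < card (?supp (\<lambda>x. h x + v x))"
      by (rule psubset_card_mono[rotated]) (simp add: assms)
    ultimately show False by simp
  qed
  with h that show ?thesis by blast
qed

text \<open>Contracting the third variable with a vector \<open>h\<close> orthogonal to all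
  \<open>w i\<close> removes the third family of slices. What remains is a matrix of rank at most
  \<open>card I + card J\<close> that is diagonal with non-zero entries on the support of
  \<open>h\<close>, and this support can be chosen with at least \<open>card A - card K\<close>
  elements.\<close>

lemma card_le_slice_rank:
  fixes F :: "'b \<Rightarrow> 'b \<Rightarrow> 'b \<Rightarrow> 'a::{field,finite}"
  assumes fin: "finite A" "finite I" "finite J" "finite K"
    and F: "\<And>x y z. \<lbrakk>x \<in> A; y \<in> A; z \<in> A\<rbrakk> \<Longrightarrow>
      F x y z = (\<Sum>i\<in>I. u i x * a i y z) + (\<Sum>i\<in>J. v i y * b i x z) + (\<Sum>i\<in>K. w i z * c i x y)"
    and diag: "\<And>x. x \<in> A \<Longrightarrow> F x x x \<noteq> 0"
    and off: "\<And>x y z. \<lbrakk>x \<in> A; y \<in> A; z \<in> A; \<not> (x = y \<and> y = z)\<rbrakk> \<Longrightarrow> F x y z = 0"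
  shows "card A \<le> card I + card J + card K"
proof (rule ccontr)
  assume less: "\<not> ?thesis"
  obtain h where h: "\<And>i. i \<in> K \<Longrightarrow> (\<Sum>z\<in>A. h z * w i z) = 0"
    and supp: "card A \<le> card {x\<in>A. h x \<noteq> 0} + card K"
    using exists_kernel_vector_large_support[OF fin(1,4), of w] by metis
  define B where "B = {x\<in>A. h x \<noteq> 0}"
  define D where "D x y = (\<Sum>z\<in>A. h z * F x y z)" for x y
  define a' where "a' i y = (\<Sum>z\<in>A. h z * a i y z)" for i y
  define b' where "b' i x = (\<Sum>z\<in>A. h z * b i x z)" for i x
  have B: "finite B" "B \<subseteq> A" using fin by (auto simp: B_def)
  have D1: "D x y = (\<Sum>i\<in>I. u i x * a' i y) + (\<Sum>i\<in>J. v i y * b' i x)" if "x \<in> A" "y \<in> A" for x y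
  proof -
    have "D x y = (\<Sum>z\<in>A. \<Sum>i\<in>I. u i x * (h z * a i y z)) + (\<Sum>z\<in>A. \<Sum>i\<in>J. v i y * (h z * b i x z))
        + (\<Sum>z\<in>A. \<Sum>i\<in>K. c i x y * (h z * w i z))"
      using that
      by (simp add: D_def F distrib_left sum.distrib sum_distrib_left mult_ac)
    also have "(\<Sum>z\<in>A. \<Sum>i\<in>I. u i x * (h z * a i y z)) = (\<Sum>i\<in>I. u i x * a' i y)"
      by (subst sum.swap) (simp add: a'_def sum_distrib_left)
    also have "(\<Sum>z\<in>A. \<Sum>i\<in>J. v i y * (h z * b i x z)) = (\<Sum>i\<in>J. v i y * b' i x)"
      by (subst sum.swap) (simp add: b'_def sum_distrib_left)
    also have "(\<Sum>z\<in>A. \<Sum>i\<in>K. c i x y * (h z * w i z)) = (\<Sum>i\<in>K. c i x y * (\<Sum>z\<in>A. h z * w i z))"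
      by (subst sum.swap) (simp add: sum_distrib_left)
    also have "\<dots> = 0" using h by simp
    finally show ?thesis by simp
  qed
  have D2: "D x y = (if x = y then h x * F x x x else 0)" if "x \<in> A" "y \<in> A" for x y
  proof -
    have "D x y = (\<Sum>z\<in>A. if z = x then h z * F x y z else 0)"
      unfolding D_def using off[of x y] that by (intro sum.cong) auto
    with fin that off[of x y x] show ?thesis by auto
  qed
  \<comment> \<open>A vector \<open>g\<close> on \<open>B\<close> orthogonal to all
    \<open>u i\<close> and all \<open>b' i\<close> annihilates the matrix \<open>D\<close> from the
    left. The disjoint sum merges the two families of constraints into one.\<close>
  have "card (I <+> J) < card B"
    using less supp fin by (simp add: card_Plus B_def)
  then obtain g where g1: "\<exists>x\<in>B. g x \<noteq> 0"
    and g: "\<And>i. i \<in> I <+> J \<Longrightarrow> (\<Sum>x\<in>B. g x * case_sum u b' i x) = 0"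
    using exists_kernel_vector[of B "I <+> J" "case_sum u b'"] B fin by (metis finite_Plus)
  have gI: "(\<Sum>x\<in>B. g x * u i x) = 0" if "i \<in> I" for i using g[of "Inl i"] that by auto
  have gJ: "(\<Sum>x\<in>B. g x * b' i x) = 0" if "i \<in> J" for i using g[of "Inr i"] that by auto
  obtain y where y: "y \<in> B" "g y \<noteq> 0" using g1 by blast
  have "(\<Sum>x\<in>B. g x * D x y) =
      (\<Sum>x\<in>B. \<Sum>i\<in>I. a' i y * (g x * u i x)) + (\<Sum>x\<in>B. \<Sum>i\<in>J. v i y * (g x * b' i x))"
    using B y by (subst sum.distrib[symmetric], intro sum.cong refl)
      (simp add: D1 subset_iff distrib_left sum_distrib_left mult_ac)
  also have "(\<Sum>x\<in>B. \<Sum>i\<in>I. a' i y * (g x * u i x)) = (\<Sum>i\<in>I. a' i y * (\<Sum>x\<in>B. g x * u i x))"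
    by (subst sum.swap) (simp add: sum_distrib_left)
  also have "(\<Sum>x\<in>B. \<Sum>i\<in>J. v i y * (g x * b' i x)) = (\<Sum>i\<in>J. v i y * (\<Sum>x\<in>B. g x * b' i x))"
    by (subst sum.swap) (simp add: sum_distrib_left)
  finally have "(\<Sum>x\<in>B. g x * D x y) = 0" using gI gJ by simp
  moreover have "(\<Sum>x\<in>B. g x * D x y) = (\<Sum>x\<in>B. if x = y then g x * (h x * F x x x) else 0)"
    using B y by (intro sum.cong) (auto simp: D2 subset_iff)
  \<comment> \<open>Only the diagonal entry survives in column \<open>y\<close>, and none of its
    three factors is zero.\<close>
  ultimately have "g y * (h y * F y y y) = 0" using B y by simp
  with y diag[of y] show False by (auto simp: B_def)
qed

section \<open>Reduced polynomial functions over a finite field\<close>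

text \<open>Multiplication by \<open>x\<close> permutes the non-zero elements, so it preserves their
  product. The result serves twice: to reduce exponents, and to make
  \<open>1 - x ^ (CARD('a) - 1)\<close> the indicator of zero.\<close>

lemma finite_field_power_card_minus_1:
  fixes x :: "'a::{field,finite}"
  assumes "x \<noteq> 0"
  shows "x ^ (CARD('a) - 1) = 1"
proof -
  let ?S = "UNIV - {0 :: 'a}"
  have "bij_betw ((*) x) ?S ?S"
    by (rule bij_betw_byWitness[of _ "\<lambda>y. y / x"]) (use assms in auto)
  then have "(\<Prod>y\<in>?S. x * y) = \<Prod>?S"
    using prod.reindex_bij_betw[of "(*) x" ?S ?S "\<lambda>y. y"] by simp
  then have "x ^ card ?S * \<Prod>?S = \<Prod>?S" by (simp add: prod.distrib)
  moreover have "\<Prod>?S \<noteq> 0" by (simp add: prod_zero_iff)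
  ultimately show ?thesis by (simp add: card_Diff_singleton)
qed

definition monomial_fun :: "'i set \<Rightarrow> ('i \<Rightarrow> nat) \<Rightarrow> ('i \<Rightarrow> 'a) \<Rightarrow> 'a::comm_monoid_mult" where
  "monomial_fun I e v = (\<Prod>i\<in>I. v i ^ e i)"

text \<open>Exponents below \<open>q\<close> suffice for functions on a field of \<open>q\<close>
  elements. Extensionality gives each exponent vector on \<open>I\<close> a single representative,
  so that these can be counted.\<close>

definition reduced_exponents :: "'i set \<Rightarrow> nat \<Rightarrow> nat \<Rightarrow> ('i \<Rightarrow> nat) set" where
  "reduced_exponents I q k = {e \<in> I \<rightarrow>\<^sub>E {..<q}. sum e I \<le> k}"

text \<open>This is a property of the function rather than of a formal polynomial, so reducing
  exponents does not change the object. The number \<open>k\<close> bounds the total degree.\<close>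

definition poly_fun_of_degree :: "'i set \<Rightarrow> nat \<Rightarrow> (('i \<Rightarrow> 'a) \<Rightarrow> 'a::{field,finite}) \<Rightarrow> bool" where
  "poly_fun_of_degree I k F \<longleftrightarrow>
     (\<exists>c. \<forall>v. F v = (\<Sum>e\<in>reduced_exponents I CARD('a) k. c e * monomial_fun I e v))"

lemma finite_reduced_exponents: "finite I \<Longrightarrow> finite (reduced_exponents I q k)"
  by (simp add: reduced_exponents_def finite_PiE)

lemma poly_fun_add:
  fixes F G :: "('i \<Rightarrow> 'a::{field,finite}) \<Rightarrow> 'a"
  assumes "poly_fun_of_degree I k F" "poly_fun_of_degree I k G"
  shows "poly_fun_of_degree I k (\<lambda>v. F v + G v)"
proof -
  obtain c d where "\<forall>v. F v = (\<Sum>e\<in>reduced_exponents I CARD('a) k. c e * monomial_fun I e v)"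
    "\<forall>v. G v = (\<Sum>e\<in>reduced_exponents I CARD('a) k. d e * monomial_fun I e v)"
    using assms unfolding poly_fun_of_degree_def by auto
  then show ?thesis unfolding poly_fun_of_degree_def
    by (intro exI[of _ "\<lambda>e. c e + d e"]) (simp add: distrib_right sum.distrib)
qed

lemma poly_fun_scale:
  fixes F :: "('i \<Rightarrow> 'a::{field,finite}) \<Rightarrow> 'a"
  assumes "poly_fun_of_degree I k F"
  shows "poly_fun_of_degree I k (\<lambda>v. a * F v)"
proof -
  obtain c where "\<forall>v. F v = (\<Sum>e\<in>reduced_exponents I CARD('a) k. c e * monomial_fun I e v)"
    using assms unfolding poly_fun_of_degree_def by auto
  then show ?thesis unfolding poly_fun_of_degree_def
    by (intro exI[of _ "\<lambda>e. a * c e"]) (simp add: sum_distrib_left mult_ac)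
qed

lemma poly_fun_zero: "poly_fun_of_degree I k (\<lambda>v. 0)"
  unfolding poly_fun_of_degree_def by (intro exI[of _ "\<lambda>e. 0"]) simp

lemma poly_fun_sum:
  assumes "finite S" "\<And>s. s \<in> S \<Longrightarrow> poly_fun_of_degree I k (F s)"
  shows "poly_fun_of_degree I k (\<lambda>v. \<Sum>s\<in>S. F s v)"
  using assms by (induction S rule: finite_induct) (auto intro: poly_fun_zero poly_fun_add)

lemma poly_fun_monomial:
  assumes "finite I" "e \<in> reduced_exponents I CARD('a) k"
  shows "poly_fun_of_degree I k (monomial_fun I e :: ('i \<Rightarrow> 'a::{field,finite}) \<Rightarrow> 'a)"
  unfolding poly_fun_of_degree_def
proof (intro exI[of _ "\<lambda>e'. if e' = e then 1 else 0"] allI)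
  fix v :: "'i \<Rightarrow> 'a"
  have "(\<Sum>e'\<in>reduced_exponents I CARD('a) k. (if e' = e then 1 else 0) * monomial_fun I e' v) =
     (\<Sum>e'\<in>reduced_exponents I CARD('a) k. if e' = e then monomial_fun I e' v else 0)"
    by (intro sum.cong) auto
  with assms show "monomial_fun I e v =
     (\<Sum>e'\<in>reduced_exponents I CARD('a) k. (if e' = e then 1 else 0) * monomial_fun I e' v)"
    by (simp add: finite_reduced_exponents)
qed

lemma poly_fun_mono:
  fixes F :: "('i \<Rightarrow> 'a::{field,finite}) \<Rightarrow> 'a"
  assumes "finite I" "k \<le> l" "poly_fun_of_degree I k F"
  shows "poly_fun_of_degree I l F"
proof -
  obtain c where c: "\<And>v. F v = (\<Sum>e\<in>reduced_exponents I CARD('a) k. c e * monomial_fun I e v)"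
    using assms unfolding poly_fun_of_degree_def by auto
  have "poly_fun_of_degree I l (\<lambda>v. \<Sum>e\<in>reduced_exponents I CARD('a) k. c e * monomial_fun I e v)"
    using assms finite_reduced_exponents
    by (intro poly_fun_sum poly_fun_scale poly_fun_monomial) (auto simp: reduced_exponents_def)
  then show ?thesis by (simp flip: c)
qed

text \<open>If the exponent of \<open>v i\<close> is already \<open>q - 1\<close>, then it is reduced to \<open>1\<close> because \<open>x\<^sup>q = x\<close>.\<close>

lemma poly_fun_mult_variable:
  fixes F :: "('i \<Rightarrow> 'a::{field,finite}) \<Rightarrow> 'a"
  assumes I: "finite I" "i \<in> I" and F: "poly_fun_of_degree I k F"
  shows "poly_fun_of_degree I (Suc k) (\<lambda>v. v i * F v)"
proof -
  have q: "1 < CARD('a)"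
    using card_mono[of "UNIV :: 'a set" "{0,1}"] by simp
  have upd: "monomial_fun I (e(i := m)) v = v i ^ m * (\<Prod>j\<in>I - {i}. v j ^ e j)"
    for e m and v :: "'i \<Rightarrow> 'a"
    using I by (simp add: monomial_fun_def prod.remove[of I i] cong: prod.cong_simp)
  have sum_upd: "sum (e(i := m)) I = m + sum e (I - {i})" for e :: "'i \<Rightarrow> nat" and m
    using I by (simp add: sum.remove[of I i] cong: sum.cong_simp)
  have mono: "poly_fun_of_degree I (Suc k) (\<lambda>v :: 'i \<Rightarrow> 'a. v i * monomial_fun I e v)"
    if e: "e \<in> reduced_exponents I CARD('a) k" for e
  proof -
    have ei: "e i < CARD('a)" "e \<in> I \<rightarrow>\<^sub>E {..<CARD('a)}" and
      le: "e i + sum e (I - {i}) \<le> k"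
      using e I sum_upd[of e "e i"] by (auto simp: reduced_exponents_def)
    define m where "m = (if Suc (e i) < CARD('a) then Suc (e i) else 1)"
    have "x * x ^ e i = x ^ m" for x :: 'a
    proof (cases "Suc (e i) < CARD('a)")
      case False
      with ei(1) have "e i = CARD('a) - 1" by simp
      with False q finite_field_power_card_minus_1[of x] show ?thesis
        by (cases "x = 0") (simp_all add: m_def)
    qed (simp add: m_def)
    then have "v i * monomial_fun I e v = monomial_fun I (e(i := m)) v" for v :: "'i \<Rightarrow> 'a"
      using upd[of e "e i" v] upd[of e m v] by (simp flip: mult.assoc)
    moreover have "e(i := m) \<in> reduced_exponents I CARD('a) (Suc k)"
      using ei I q le sum_upd[of e m]
      by (auto simp: reduced_exponents_def m_def PiE_iff extensional_def)
    ultimately show ?thesis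
      using poly_fun_monomial[OF I(1), of "e(i := m)" "Suc k"] by (simp add: fun_eq_iff[symmetric])
  qed
  obtain c where c: "\<And>v. F v = (\<Sum>e\<in>reduced_exponents I CARD('a) k. c e * monomial_fun I e v)"
    using F unfolding poly_fun_of_degree_def by auto
  have "poly_fun_of_degree I (Suc k)
     (\<lambda>v. \<Sum>e\<in>reduced_exponents I CARD('a) k. c e * (v i * monomial_fun I e v))"
    using mono finite_reduced_exponents[OF I(1)] by (intro poly_fun_sum poly_fun_scale)
  then show ?thesis by (simp add: c sum_distrib_left mult_ac)
qed

lemma poly_fun_mult_linear_power:
  assumes "finite I" "poly_fun_of_degree I k F"
  shows "poly_fun_of_degree I (k + m) (\<lambda>v. (\<Sum>i\<in>I. a i * v i) ^ m * F v)"
proof (induction m)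
  case (Suc m)
  have "poly_fun_of_degree I (Suc (k + m))
     (\<lambda>v. \<Sum>i\<in>I. a i * (v i * ((\<Sum>i\<in>I. a i * v i) ^ m * F v)))"
    using assms Suc by (intro poly_fun_sum poly_fun_scale poly_fun_mult_variable)
  then show ?case by (simp add: sum_distrib_right mult.assoc)
qed (use assms in simp)

text \<open>The product is the indicator of the common zeros of \<open>N\<close> linear forms, and
  each factor raises the degree bound by \<open>CARD('a) - 1\<close>.\<close>

lemma poly_fun_linear_system_indicator:
  fixes a :: "nat \<Rightarrow> 'i \<Rightarrow> 'a::{field,finite}"
  assumes "finite I"
  shows "poly_fun_of_degree I ((CARD('a) - 1) * N)
     (\<lambda>v. \<Prod>j<N. 1 - (\<Sum>i\<in>I. a j i * v i) ^ (CARD('a) - 1))"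
proof (induction N)
  case 0
  have "(\<lambda>i\<in>I. 0) \<in> reduced_exponents I CARD('a) 0"
    by (auto simp: reduced_exponents_def)
  from poly_fun_monomial[OF assms this] show ?case
    by (simp add: monomial_fun_def[abs_def])
next
  case (Suc N)
  let ?F = "\<lambda>v. \<Prod>j<N. 1 - (\<Sum>i\<in>I. a j i * v i) ^ (CARD('a) - 1)"
  let ?k = "(CARD('a) - 1) * N + (CARD('a) - 1)"
  have "poly_fun_of_degree I ?k (\<lambda>v. ?F v + (-1) * ((\<Sum>i\<in>I. a N i * v i) ^ (CARD('a) - 1) * ?F v))"
    using assms Suc
    by (intro poly_fun_add poly_fun_scale poly_fun_mult_linear_power poly_fun_mono[OF _ _ Suc]) auto
  then show ?case by (simp add: algebra_simps)
qed

section \<open>Counting reduced monomials of low degree\<close>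

text \<open>For uniformly random \<open>e\<close> the values \<open>w (e i)\<close> are independent
  with mean zero, so the variance of their sum is the sum of their variances. The power of
  \<open>card B\<close> turns the expectation into a sum.\<close>

lemma sum_PiE_square_le:
  fixes w :: "'b \<Rightarrow> real"
  assumes fin: "finite I" "finite B" and w0: "(\<Sum>b\<in>B. w b) = 0"
    and s: "\<And>b. b \<in> B \<Longrightarrow> (w b)\<^sup>2 \<le> s"
  shows "(\<Sum>e\<in>I \<rightarrow>\<^sub>E B. (\<Sum>i\<in>I. w (e i))\<^sup>2) \<le> real (card I) * s * real (card B) ^ card I"
proof -
  let ?P = "I \<rightarrow>\<^sub>E B"
  have off: "(\<Sum>e\<in>?P. w (e i) * w (e j)) = 0" if ij: "i \<in> I" "j \<in> I" "i \<noteq> j" for i j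
  proof -
    \<comment> \<open>Padding with ones gives a product over all coordinates, whose sum over
      \<open>?P\<close> factorises; the factor at \<open>i\<close> is zero.\<close>
    let ?g = "\<lambda>l b. if l = i \<or> l = j then w b else 1"
    have "(\<Sum>e\<in>?P. w (e i) * w (e j)) = (\<Sum>e\<in>?P. \<Prod>l\<in>I. ?g l (e l))"
    proof (intro sum.cong refl)
      fix e
      have "(\<Prod>l\<in>I. ?g l (e l)) = (\<Prod>l\<in>{i,j}. w (e l))"
        using fin ij by (intro prod.mono_neutral_cong_right) auto
      with ij show "w (e i) * w (e j) = (\<Prod>l\<in>I. ?g l (e l))" by simp
    qed
    also have "\<dots> = (\<Prod>l\<in>I. \<Sum>b\<in>B. ?g l b)"
      using fin by (intro prod_sum_PiE[symmetric]) auto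
    also have "\<dots> = 0"
      using fin ij(1) w0 by (auto simp: prod_zero_iff intro!: bexI[of _ i])
    finally show ?thesis .
  qed
  have "(\<Sum>e\<in>?P. (\<Sum>i\<in>I. w (e i))\<^sup>2) = (\<Sum>e\<in>?P. \<Sum>i\<in>I. \<Sum>j\<in>I. w (e i) * w (e j))"
    by (simp add: power2_eq_square sum_product)
  also have "\<dots> = (\<Sum>i\<in>I. \<Sum>j\<in>I. \<Sum>e\<in>?P. w (e i) * w (e j))"
    by (subst sum.swap, intro sum.cong refl, rule sum.swap)
  also have "\<dots> = (\<Sum>i\<in>I. \<Sum>j\<in>I. if j = i then \<Sum>e\<in>?P. (w (e i))\<^sup>2 else 0)"
    using off by (intro sum.cong refl) (auto simp: power2_eq_square)
  also have "\<dots> = (\<Sum>i\<in>I. \<Sum>e\<in>?P. (w (e i))\<^sup>2)" using fin by simp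
  also have "\<dots> \<le> (\<Sum>i\<in>I. \<Sum>e\<in>?P. s)"
    using s by (intro sum_mono) auto
  also have "\<dots> = real (card I) * s * real (card B) ^ card I"
    using fin by (simp add: card_PiE mult_ac)
  finally show ?thesis .
qed

text \<open>This is Chebyshev's inequality: the degree has mean \<open>(q - 1) * n / 2\<close>, and
  \<open>4 * d \<le> n\<close> keeps the threshold below the mean by a fixed proportion of
  it.\<close>

lemma card_low_degree_exponents_le:
  fixes q n d :: nat
  assumes q: "q \<ge> 2" and n: "n > 0" "4 * d \<le> n"
  shows "real (card {e \<in> {..<n} \<rightarrow>\<^sub>E {..<q}. 3 * sum e {..<n} \<le> (q - 1) * (n + d)})
    \<le> 36 * real q ^ n / real n"
proof -
  define p where "p = real (q - 1)"
  \<comment> \<open>This is twice the amount by which an exponent falls short of its mean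
    \<open>p / 2\<close>, hence bounded by \<open>p\<close> in absolute value.\<close>
  define w where "w b = p - 2 * real b" for b
  let ?P = "{..<n} \<rightarrow>\<^sub>E {..<q}"
  let ?M = "{e \<in> ?P. 3 * sum e {..<n} \<le> (q - 1) * (n + d)}"
  have p: "p \<ge> 1" using q by (simp add: p_def)
  have finP: "finite ?P" by (intro finite_PiE) auto
  \<comment> \<open>The last factor vanishes at \<open>m = q\<close>.\<close>
  have "(\<Sum>b<m. w b) = real m * (p - real m + 1)" for m
    by (induction m) (auto simp: w_def algebra_simps)
  then have w0: "(\<Sum>b<q. w b) = 0" using q by (simp add: p_def of_nat_diff)
  have wp: "(w b)\<^sup>2 \<le> p\<^sup>2" if "b \<in> {..<q}" for b
    using that q by (intro abs_le_square_iff[THEN iffD1]) (auto simp: w_def p_def of_nat_diff abs_le_iff)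
  \<comment> \<open>The sum is at least \<open>p * n - 2 * p * (n + d) / 3\<close>, which is at
    least \<open>p * n / 6\<close> because \<open>d\<close> is at most \<open>n / 4\<close>. The
    square of 6 is the constant 36.\<close>
  have "(p * n / 6)\<^sup>2 \<le> (\<Sum>i<n. w (e i))\<^sup>2" if "e \<in> ?M" for e
  proof (rule power_mono)
    have "3 * real (sum e {..<n}) \<le> p * (real n + real d)"
      using that of_nat_mono[of "3 * sum e {..<n}" "(q - 1) * (n + d)", where 'a = real]
      by (simp add: p_def)
    moreover have "p * (4 * real d) \<le> p * n"
      using n p by (intro mult_left_mono) linarith+
    moreover have "(\<Sum>i<n. w (e i)) = p * n - 2 * real (sum e {..<n})"
      by (simp add: w_def sum_subtractf sum_distrib_left)
    ultimately show "p * n / 6 \<le> (\<Sum>i<n. w (e i))" by (simp add: algebra_simps)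
  qed (use p in simp)
  then have "(\<Sum>e\<in>?M. (p * n / 6)\<^sup>2) \<le> (\<Sum>e\<in>?M. (\<Sum>i<n. w (e i))\<^sup>2)"
    by (rule sum_mono)
  also have "\<dots> \<le> (\<Sum>e\<in>?P. (\<Sum>i<n. w (e i))\<^sup>2)"
    using finP by (intro sum_mono2) auto
  also have "\<dots> \<le> real n * p\<^sup>2 * real q ^ n"
    using sum_PiE_square_le[of "{..<n}" "{..<q}" w "p\<^sup>2"] w0 wp by simp
  finally have "(p\<^sup>2 * n) * (card ?M * n) \<le> (p\<^sup>2 * n) * (36 * real q ^ n)"
    by (simp add: power2_eq_square field_simps)
  then have "card ?M * real n \<le> 36 * real q ^ n"
    using p n by (subst (asm) mult_le_cancel_left_pos) auto
  with n show ?thesis by (simp add: field_simps)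
qed

section \<open>Sets without non-trivial solutions\<close>

text \<open>This exhibits the coefficient as a linear form in the \<open>n\<close> coefficients of
  \<open>x\<close>. The guard \<open>i \<le> j\<close> is essential, since truncated subtraction
  would otherwise contribute \<open>coeff c 0\<close>.\<close>

lemma coeff_mult_polys_deg_less:
  assumes "x \<in> polys_deg_less n"
  shows "coeff (c * x) j = (\<Sum>i<n. (if i \<le> j then coeff c (j - i) else 0) * coeff x i)"
proof -
  have x0: "coeff x i = 0" if "i \<ge> n" for i
    using assms that by (auto simp: polys_deg_less_def coeff_eq_0)
  have "coeff (c * x) j = (\<Sum>i\<le>j. coeff x i * coeff c (j - i))"
    by (simp add: mult.commute[of c] coeff_mult)
  also have "\<dots> = (\<Sum>i<n. (if i \<le> j then coeff c (j - i) else 0) * coeff x i)"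
    using x0 by (intro sum.mono_neutral_cong) (auto simp: mult.commute not_less)
  finally show ?thesis .
qed

lemma coeff_mult_eq_0:
  assumes "x \<in> polys_deg_less n" "degree c \<le> d" "j \<ge> n + d"
  shows "coeff (c * x) j = 0"
proof (cases "x = 0")
  case False
  with assms have "degree (c * x) < j"
    using degree_mult_le[of c x] by (auto simp: polys_deg_less_def)
  then show ?thesis by (rule coeff_eq_0)
qed simp

text \<open>The slice rank bound applies to the indicator of the equation: \<open>c0\<close> makes
  it non-zero on the diagonal, \<open>triv\<close> makes it vanish elsewhere on \<open>A\<close>,
  and each unknown accounts for one copy of the low-degree monomials.\<close>

lemma card_solution_free_le:
  fixes c1 c2 c3 :: "'a::{field,finite} poly"
  assumes A: "A \<subseteq> polys_deg_less n" and c0: "c1 + c2 + c3 = 0"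
    and triv: "\<forall>x\<in>solutions_in c1 c2 c3 A. trivial_triple x"
    and d: "degree c1 \<le> d" "degree c2 \<le> d" "degree c3 \<le> d"
  shows "card A \<le>
    3 * card {e \<in> {..<n} \<rightarrow>\<^sub>E {..<CARD('a)}. 3 * sum e {..<n} \<le> (CARD('a) - 1) * (n + d)}"
proof -
  define M where
    "M = {e \<in> {..<n} \<rightarrow>\<^sub>E {..<CARD('a)}. 3 * sum e {..<n} \<le> (CARD('a) - 1) * (n + d)}"
  \<comment> \<open>The pair \<open>(s, i)\<close> stands for coefficient \<open>i\<close> of
    unknown \<open>s\<close>. Accordingly \<open>X\<close> joins three coefficient vectors into one,
    and \<open>r s\<close> cuts block \<open>s\<close> out of an exponent vector.\<close>
  define I where "I = {..<3::nat} \<times> {..<n}"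
  define a where "a j = (\<lambda>(s, i). if i \<le> j then coeff ([c1, c2, c3] ! s) (j - i) else 0)" for j
  define X where "X x y z = (\<lambda>(s, i). coeff ([x, y, z] ! s) i)" for x y z :: "'a poly"
  define F where "F x y z = (\<Prod>j<n + d. 1 - coeff (c1 * x + c2 * y + c3 * z) j ^ (CARD('a) - 1))"
    for x y z
  define mm where "mm e x = monomial_fun {..<n} e (coeff x)" for e and x :: "'a poly"
  define r where "r s e = (\<lambda>i\<in>{..<n}. e (s, i))" for s :: nat and e :: "nat \<times> nat \<Rightarrow> nat"
  define E where "E = reduced_exponents I CARD('a) ((CARD('a) - 1) * (n + d))"
  have finM: "finite M" by (simp add: M_def finite_PiE)
  have "finite I" by (simp add: I_def)
  then have finE: "finite E" by (simp add: E_def finite_reduced_exponents)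
  have finA: "finite A"
  proof (rule finite_subset[OF A])
    have "card (polys_deg_less n :: 'a poly set) > 0" by (simp add: card_polys_deg_less)
    then show "finite (polys_deg_less n :: 'a poly set)" by (rule card_ge_0_finite)
  qed
  have three: "{..<3::nat} = {0, 1, 2}" by auto
  have sum_I: "sum g I = (\<Sum>s<3. \<Sum>i<n. g (s, i))" for g :: "nat \<times> nat \<Rightarrow> 'b::comm_monoid_add"
    by (simp add: I_def sum.cartesian_product case_prod_unfold)
  have prod_I: "prod g I = (\<Prod>s<3. \<Prod>i<n. g (s, i))" for g :: "nat \<times> nat \<Rightarrow> 'a"
    by (simp add: I_def prod.cartesian_product case_prod_unfold)
  have lin: "(\<Sum>p\<in>I. a j p * X x y z p) = coeff (c1 * x + c2 * y + c3 * z) j"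
    if "x \<in> A" "y \<in> A" "z \<in> A" for x y z j
  proof -
    have "x \<in> polys_deg_less n" "y \<in> polys_deg_less n" "z \<in> polys_deg_less n"
      using that A by auto
    then show ?thesis
      by (simp add: sum_I three a_def X_def coeff_mult_polys_deg_less add.assoc cong: if_cong)
  qed
  have "\<exists>\<kappa>. \<forall>v. (\<Prod>j<n + d. 1 - (\<Sum>p\<in>I. a j p * v p) ^ (CARD('a) - 1)) =
      (\<Sum>e\<in>E. \<kappa> e * monomial_fun I e v)"
    using poly_fun_linear_system_indicator[OF \<open>finite I\<close>, of "n + d" a]
    unfolding poly_fun_of_degree_def E_def .
  then obtain \<kappa> where \<kappa>: "\<forall>v. (\<Prod>j<n + d. 1 - (\<Sum>p\<in>I. a j p * v p) ^ (CARD('a) - 1)) =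
      (\<Sum>e\<in>E. \<kappa> e * monomial_fun I e v)"
    ..
  have mono: "monomial_fun I e (X x y z) = mm (r 0 e) x * (mm (r 1 e) y * mm (r 2 e) z)" for e x y z
    by (simp add: monomial_fun_def mm_def prod_I three X_def r_def)
  have F: "F x y z = (\<Sum>e\<in>E. \<kappa> e * (mm (r 0 e) x * (mm (r 1 e) y * mm (r 2 e) z)))"
    if "x \<in> A" "y \<in> A" "z \<in> A" for x y z
    using \<kappa>[rule_format, of "X x y z"] that by (simp add: F_def lin mono)
  \<comment> \<open>Each monomial is assigned to the first block in which its degree is low. The
    classes are disjoint, so no term is counted twice.\<close>
  define T0 where "T0 = {e \<in> E. r 0 e \<in> M}"
  define T1 where "T1 = {e \<in> E - T0. r 1 e \<in> M}"
  define T2 where "T2 = E - T0 - T1"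
  \<comment> \<open>When two block degrees exceed a third of the bound on the total degree, the
    remaining one cannot.\<close>
  have "r 2 e \<in> M" if e: "e \<in> T2" for e
  proof -
    have e': "e \<in> I \<rightarrow>\<^sub>E {..<CARD('a)}" "sum e I \<le> (CARD('a) - 1) * (n + d)"
      using e by (auto simp: T2_def E_def reduced_exponents_def)
    have "sum e I = sum (r 0 e) {..<n} + (sum (r 1 e) {..<n} + sum (r 2 e) {..<n})"
      by (simp add: sum_I three r_def)
    moreover have r: "r s e \<in> {..<n} \<rightarrow>\<^sub>E {..<CARD('a)}" if "s < 3" for s
      using e'(1) that by (auto simp: r_def I_def PiE_iff)
    moreover have "r 0 e \<notin> M" "r 1 e \<notin> M" using e by (auto simp: T2_def T1_def T0_def)
    then have "3 * sum (r 0 e) {..<n} > (CARD('a) - 1) * (n + d)"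
      "3 * sum (r 1 e) {..<n} > (CARD('a) - 1) * (n + d)"
      using r[of 0] r[of 1] by (simp_all add: M_def)
    ultimately have "3 * sum (r 2 e) {..<n} \<le> (CARD('a) - 1) * (n + d)" using e'(2) by linarith
    with r[of 2] show ?thesis by (simp add: M_def)
  qed
  then have T: "r 0 ` T0 \<subseteq> M" "r 1 ` T1 \<subseteq> M" "r 2 ` T2 \<subseteq> M"
    by (auto simp: T0_def T1_def)
  have finT: "finite T0" "finite T1" "finite T2"
    using finE by (auto simp: T0_def T1_def T2_def)
  have split: "sum g E = sum g T0 + sum g T1 + sum g T2" for g :: "(nat \<times> nat \<Rightarrow> nat) \<Rightarrow> 'a"
  proof -
    have "sum g E = sum g T0 + sum g (E - T0)"
      using finE by (subst add.commute, intro sum.subset_diff) (auto simp: T0_def)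
    also have "sum g (E - T0) = sum g T1 + sum g T2"
      unfolding T2_def using finE by (subst add.commute, intro sum.subset_diff) (auto simp: T1_def)
    finally show ?thesis by (simp add: add.assoc)
  qed
  have "card A \<le> card M + card M + card M"
  proof (rule card_le_slice_rank[OF finA finM finM finM, of F mm])
    fix x y z assume xyz: "x \<in> A" "y \<in> A" "z \<in> A"
    let ?g = "\<lambda>e. \<kappa> e * (mm (r 0 e) x * (mm (r 1 e) y * mm (r 2 e) z))"
    \<comment> \<open>Collecting the terms that share the factor \<open>mm f x\<close> leaves one
      slice for each \<open>f\<close> in \<open>M\<close>. The other two classes are grouped
      likewise by their own low-degree block.\<close>
    have "sum ?g T0 = (\<Sum>f\<in>M. mm f x * (\<Sum>e\<in>{e\<in>T0. r 0 e = f}. \<kappa> e * (mm (r 1 e) y * mm (r 2 e) z)))"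
      by (subst sum.group[OF finT(1) finM T(1), symmetric])
        (auto simp: sum_distrib_left mult_ac intro!: sum.cong)
    moreover have "sum ?g T1 = (\<Sum>f\<in>M. mm f y * (\<Sum>e\<in>{e\<in>T1. r 1 e = f}. \<kappa> e * (mm (r 0 e) x * mm (r 2 e) z)))"
      by (subst sum.group[OF finT(2) finM T(2), symmetric])
        (auto simp: sum_distrib_left mult_ac intro!: sum.cong)
    moreover have "sum ?g T2 = (\<Sum>f\<in>M. mm f z * (\<Sum>e\<in>{e\<in>T2. r 2 e = f}. \<kappa> e * (mm (r 0 e) x * mm (r 1 e) y)))"
      by (subst sum.group[OF finT(3) finM T(3), symmetric])
        (auto simp: sum_distrib_left mult_ac intro!: sum.cong)
    ultimately show "F x y z =
        (\<Sum>f\<in>M. mm f x * (\<Sum>e\<in>{e\<in>T0. r 0 e = f}. \<kappa> e * (mm (r 1 e) y * mm (r 2 e) z))) +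
        (\<Sum>f\<in>M. mm f y * (\<Sum>e\<in>{e\<in>T1. r 1 e = f}. \<kappa> e * (mm (r 0 e) x * mm (r 2 e) z))) +
        (\<Sum>f\<in>M. mm f z * (\<Sum>e\<in>{e\<in>T2. r 2 e = f}. \<kappa> e * (mm (r 0 e) x * mm (r 1 e) y)))"
      by (simp add: F[OF xyz] split)
  next
    fix x assume "x \<in> A"
    have "c1 * x + c2 * x + c3 * x = 0" using c0 by (simp flip: distrib_right)
    moreover have "CARD('a) - 1 \<noteq> 0"
      using card_mono[of "UNIV :: 'a set" "{0,1}"] by simp
    ultimately show "F x x x \<noteq> 0" by (simp add: F_def power_0_left)
  next
    fix x y z assume xyz: "x \<in> A" "y \<in> A" "z \<in> A" "\<not> (x = y \<and> y = z)"
    then have "c1 * x + c2 * y + c3 * z \<noteq> 0"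
      using triv[rule_format, of "(x, y, z)"] by (auto simp: solutions_in_def trivial_triple_def)
    then obtain j where j: "coeff (c1 * x + c2 * y + c3 * z) j \<noteq> 0" by (auto simp: poly_eq_iff)
    \<comment> \<open>The non-zero coefficient must be among those tested by \<open>F\<close>; its
      factor is then zero.\<close>
    have "j < n + d"
    proof (rule ccontr)
      assume "\<not> j < n + d"
      moreover have "x \<in> polys_deg_less n" "y \<in> polys_deg_less n" "z \<in> polys_deg_less n"
        using xyz A by auto
      ultimately show False using j d by (simp add: coeff_mult_eq_0)
    qed
    then show "F x y z = 0"
      unfolding F_def using finite_field_power_card_minus_1[OF j]
      by (intro prod_zero bexI[of _ j]) simp_all
  qed
  then show ?thesis by (simp add: M_def)
qed

theorem theorem1p4:
  fixes c1 c2 c3 :: "'a::{field,finite} poly"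
  assumes "odd CARD('a)"
    and "c1 \<noteq> 0" and "c2 \<noteq> 0" and "c3 \<noteq> 0"
    and "c1 + c2 + c3 = 0"
  shows "\<exists>C::real. C > 0 \<and>
    (\<forall>n::nat. n \<ge> 2 \<longrightarrow>
      (\<forall>A. A \<subseteq> polys_deg_less n \<longrightarrow>
        (\<forall>x \<in> solutions_in c1 c2 c3 A. trivial_triple x) \<longrightarrow>
        real (card A) \<le> C * ((ln (real n))\<^sup>2 / real n) * real CARD('a) ^ n))"
proof -
  define d where "d = max (degree c1) (max (degree c2) (degree c3))"
  \<comment> \<open>The summand 108 is 3 times 36, for \<open>4 * d \<le> n\<close>. For smaller
    \<open>n\<close> the trivial bound \<open>Q ^ n\<close> is enough, as then
    \<open>4 * d / n\<close> exceeds 1.\<close>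
  define K where "K = 108 + 4 * real d"
  define Q where "Q = real CARD('a)"
  have q: "CARD('a) \<ge> 2"
    using card_mono[of "UNIV :: 'a set" "{0,1}"] by simp
  have bound: "real (card A) \<le> K * Q ^ n / n"
    if n: "n \<ge> 2" and A: "A \<subseteq> polys_deg_less n"
      and triv: "\<forall>x \<in> solutions_in c1 c2 c3 A. trivial_triple x" for n and A :: "'a poly set"
  proof (cases "4 * d \<le> n")
    case True
    have "real (card A) \<le> real (3 * card {e \<in> {..<n} \<rightarrow>\<^sub>E {..<CARD('a)}.
        3 * sum e {..<n} \<le> (CARD('a) - 1) * (n + d)})"
      using card_solution_free_le[OF A assms(5) triv, of d] unfolding of_nat_le_iff d_def by simp
    also have "\<dots> \<le> 3 * (36 * Q ^ n / n)"
      unfolding Q_def using card_low_degree_exponents_le[OF q, of n d] n True by simp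
    also have "\<dots> \<le> K * Q ^ n / n"
      using n by (simp add: K_def Q_def field_simps)
    finally show ?thesis .
  next
    case False
    have "card (polys_deg_less n :: 'a poly set) > 0" by (simp add: card_polys_deg_less)
    then have "card A \<le> card (polys_deg_less n :: 'a poly set)"
      using A by (intro card_mono card_ge_0_finite)
    then have "real (card A) \<le> Q ^ n"
      by (simp add: card_polys_deg_less Q_def flip: of_nat_power)
    also have "\<dots> \<le> (K / n) * Q ^ n"
      using n False by (intro mult_le_cancel_right1[THEN iffD2]) (auto simp: K_def Q_def field_simps)
    finally show ?thesis by simp
  qed
  show ?thesis
  \<comment> \<open>Since \<open>n \<ge> 2\<close>, the factor
    \<open>(ln n)\<^sup>2 / (ln 2)\<^sup>2\<close> is at least 1, so inserting it only weakens the
    bound of order \<open>Q ^ n / n\<close>.\<close>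
  proof (intro exI[of _ "K / (ln 2)\<^sup>2"] conjI allI impI)
    show "K / (ln 2)\<^sup>2 > 0" by (simp add: K_def)
    fix n :: nat and A :: "'a poly set"
    assume n: "n \<ge> 2" and A: "A \<subseteq> polys_deg_less n"
      "\<forall>x \<in> solutions_in c1 c2 c3 A. trivial_triple x"
    have "(ln 2)\<^sup>2 \<le> (ln (real n))\<^sup>2"
      using n by (intro power_mono) auto
    then have "1 \<le> (ln (real n))\<^sup>2 / (ln 2)\<^sup>2" by simp
    moreover have "0 \<le> K * Q ^ n / n" by (simp add: K_def Q_def)
    ultimately have "K * Q ^ n / n * 1 \<le> K * Q ^ n / n * ((ln (real n))\<^sup>2 / (ln 2)\<^sup>2)"
      by (rule mult_left_mono)
    with bound[OF n A]
    have "real (card A) \<le> K * Q ^ n / n * ((ln (real n))\<^sup>2 / (ln 2)\<^sup>2)"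
      by linarith
    then show "real (card A) \<le> K / (ln 2)\<^sup>2 * ((ln (real n))\<^sup>2 / real n) * real CARD('a) ^ n"
      by (simp add: Q_def mult_ac)
  qed
qed

end
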